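(* Fix integers $2\le l<r$. Then for all sufficiently large $k$, $$m_k(r,l)<c_{r,l}\,(k^{r-1}\log k)^{l/(l-1)},\qquad\text{where}\quad c_{r,l}=2\left(\frac{100\,(r)_l^2}{l!}\right)^{1/(l-1)}\left(\frac{10(r-1)}{l-1}\right)^{l/(l-1)}.$$
   Context: An $r$-graph is a hypergraph all of whose edges have exactly $r$ vertices. An $(r,l)$-system is an $r$-graph in which every two distinct edges share fewer than $l$ vertices. The chromatic number of a hypergraph is the minimum number of colors in a vertex coloring with no monochromatic edge. $m_k(r,l)$ denotes the minimum number of edges in an $(r,l)$-system with chromatic number greater than $k$. $(r)_l=r(r-1)\cdots(r-l+1)$ is the falling factorial, and $\log$ is the natural logarithm. *)

theory Defs
  imports "HOL-Analysis.Analysis"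
begin

text \<open>
  A finite hypergraph is given by its vertex set \<open>V\<close> and its edge set \<open>E\<close>.
\<close>

definition hypergraph :: "'a set \<Rightarrow> 'a set set \<Rightarrow> bool" where
  "hypergraph V E \<longleftrightarrow> finite V \<and> (\<forall>e\<in>E. e \<subseteq> V)"

definition r_graph :: "nat \<Rightarrow> 'a set \<Rightarrow> 'a set set \<Rightarrow> bool" where
  "r_graph r V E \<longleftrightarrow> hypergraph V E \<and> (\<forall>e\<in>E. card e = r)"

definition rl_system :: "nat \<Rightarrow> nat \<Rightarrow> 'a set \<Rightarrow> 'a set set \<Rightarrow> bool" where
  "rl_system r l V E \<longleftrightarrow>
     r_graph r V E \<and> (\<forall>e\<in>E. \<forall>e'\<in>E. e \<noteq> e' \<longrightarrow> card (e \<inter> e') < l)"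

definition monochromatic :: "('a \<Rightarrow> nat) \<Rightarrow> 'a set \<Rightarrow> bool" where
  "monochromatic f e \<longleftrightarrow> (\<exists>c. \<forall>v\<in>e. f v = c)"

definition proper_coloring :: "'a set \<Rightarrow> 'a set set \<Rightarrow> nat \<Rightarrow> ('a \<Rightarrow> nat) \<Rightarrow> bool" where
  "proper_coloring V E k f \<longleftrightarrow> f ` V \<subseteq> {..<k} \<and> (\<forall>e\<in>E. \<not> monochromatic f e)"

text \<open>
  Both minima below are infima in \<^typ>\<open>enat\<close>, so that the minimum of the empty set is \<open>\<infinity>\<close>
  and not, as for \<^typ>\<open>nat\<close>, the value \<open>0\<close>. In particular an upper bound on \<open>min_edges\<close>
  includes the existence of the systems in question.
\<close>

definition chromatic_number :: "'a set \<Rightarrow> 'a set set \<Rightarrow> enat" where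
  "chromatic_number V E = (INF k \<in> {k. \<exists>f. proper_coloring V E k f}. enat k)"

text \<open>
  Every finite hypergraph is isomorphic to one whose vertices are natural numbers, so vertices
  of type \<^typ>\<open>nat\<close> lose no generality. The edge set is finite, since the vertex set is.
\<close>

definition min_edges :: "nat \<Rightarrow> nat \<Rightarrow> nat \<Rightarrow> enat" where
  "min_edges k r l =
     (INF (V, E) \<in> {(V :: nat set, E). rl_system r l V E \<and> chromatic_number V E > enat k}.
        enat (card E))"

definition falling_factorial :: "nat \<Rightarrow> nat \<Rightarrow> real" where
  "falling_factorial r l = (\<Prod>i<l. real r - real i)"

definition c_const :: "nat \<Rightarrow> nat \<Rightarrow> real" where
  "c_const r l =
     2 * (100 * (falling_factorial r l)\<^sup>2 / fact l) powr (1 / (real l - 1))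
       * (10 * (real r - 1) / (real l - 1)) powr (real l / (real l - 1))"

end

theory Submission
  imports Defs
begin

text \<open>
  Take \<open>n = k s\<close> vertices. If every \<open>s\<close>-set of vertices contains an edge, no \<open>k\<close>-colouring is
  proper, since some colour class has at least \<open>s\<close> vertices. The edges are chosen one at a time
  among the \<open>r\<close>-sets that meet every earlier edge in fewer than \<open>l\<close> vertices. As long as few of
  the \<open>l\<close>-subsets of \<open>S\<close> are covered by edges, about half of the \<open>r\<close>-subsets of \<open>S\<close> are still
  available, so a random available edge lies in \<open>S\<close> with probability of order \<open>k\<^sup>-\<^sup>r\<close>. The
  sets \<open>S\<close> that are covered too much are controlled by an exponential moment of the number of
  covered \<open>l\<close>-subsets: its exponent is of order \<open>s\<^sup>l\<close>, and \<open>s\<^sup>l\<^sup>-\<^sup>1\<close> is of order at least \<open>k ln k\<close>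
  because \<open>l < r\<close>, which beats the entropy \<open>s ln k\<close> of the choice of \<open>S\<close>. Both estimates enter one
  potential, which some available edge does not increase, and about \<open>8 n k\<^sup>r\<^sup>-\<^sup>1 ln k\<close> edges suffice.
\<close>

section \<open>Available edges, covered \<open>l\<close>-subsets and edge-free sets\<close>

definition subsets_of_card :: "'a set \<Rightarrow> nat \<Rightarrow> 'a set set" where
  "subsets_of_card V r = {e. e \<subseteq> V \<and> card e = r}"

text \<open>Used with \<open>S\<close> the whole vertex set, for the candidates for the next edge,
  and with \<open>S\<close> an \<open>s\<close>-set, for those candidates that lie in
  \<open>S\<close>.\<close>

definition allowed :: "nat \<Rightarrow> nat \<Rightarrow> 'a set set \<Rightarrow> 'a set \<Rightarrow> 'a set set" where
  "allowed r l M S = {e \<in> subsets_of_card S r. \<forall>f\<in>M. card (e \<inter> f) < l}"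

text \<open>In an \<open>(r,l)\<close>-system no \<open>l\<close>-set lies in two edges, so this
  counts the \<open>l\<close>-subsets of \<open>S\<close> covered by edges. Being a sum over edges,
  it has an exponential that is multiplicative in \<open>M\<close>.\<close>

definition load :: "nat \<Rightarrow> 'a set set \<Rightarrow> 'a set \<Rightarrow> nat" where
  "load l M S = (\<Sum>f\<in>M. card (f \<inter> S) choose l)"

definition independent_sets :: "'a set \<Rightarrow> nat \<Rightarrow> 'a set set \<Rightarrow> 'a set set" where
  "independent_sets V s M = {S \<in> subsets_of_card V s. \<forall>e\<in>M. \<not> e \<subseteq> S}"

lemma finite_subsets_of_card [simp]: "finite V \<Longrightarrow> finite (subsets_of_card V r)"
  by (simp add: subsets_of_card_def)

lemma card_subsets_of_card [simp]: "finite V \<Longrightarrow> card (subsets_of_card V r) = card V choose r"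
  by (simp add: subsets_of_card_def n_subsets)

lemma finite_allowed [simp]: "finite S \<Longrightarrow> finite (allowed r l M S)"
  by (simp add: allowed_def)

section \<open>Double counting of \<open>r\<close>-sets and their \<open>l\<close>-subsets\<close>

text \<open>Deleting \<open>A\<close> is injective on its supersets. For \<open>card A > r\<close>
  no such \<open>e\<close> exists, while truncated subtraction makes the right side 1.\<close>

lemma card_supersets_le:
  assumes "finite V" "A \<subseteq> V"
  shows "card {e \<in> subsets_of_card V r. A \<subseteq> e} \<le> (card V - card A) choose (r - card A)"
proof -
  have fA: "finite A" using assms finite_subset by blast
  have "card {e \<in> subsets_of_card V r. A \<subseteq> e} \<le> card (subsets_of_card (V - A) (r - card A))"
  proof (rule card_inj_on_le)
    show "inj_on (\<lambda>e. e - A) {e \<in> subsets_of_card V r. A \<subseteq> e}"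
      by (auto simp: inj_on_def)
    show "(\<lambda>e. e - A) ` {e \<in> subsets_of_card V r. A \<subseteq> e} \<subseteq> subsets_of_card (V - A) (r - card A)"
      using fA by (auto simp: subsets_of_card_def card_Diff_subset)
  qed (use assms in auto)
  also have "\<dots> = (card V - card A) choose (r - card A)"
    using assms fA by (simp add: card_Diff_subset)
  finally show ?thesis .
qed

text \<open>A blocked \<open>e\<close> contains some \<open>l\<close>-subset \<open>A\<close> of
  \<open>f \<inter> S\<close>; a union bound over \<open>A\<close> counts the supersets of
  each.\<close>

lemma card_blocked_le:
  assumes "finite S"
  shows "card {e \<in> subsets_of_card S r. l \<le> card (e \<inter> f)}
    \<le> (card (f \<inter> S) choose l) * ((card S - l) choose (r - l))"
proof -
  have "{e \<in> subsets_of_card S r. l \<le> card (e \<inter> f)}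
    \<subseteq> (\<Union>A \<in> subsets_of_card (f \<inter> S) l. {e \<in> subsets_of_card S r. A \<subseteq> e})"
  proof
    fix e assume e: "e \<in> {e \<in> subsets_of_card S r. l \<le> card (e \<inter> f)}"
    then have "l \<le> card (e \<inter> f)" by simp
    then obtain A where "A \<subseteq> e \<inter> f" "card A = l"
      using obtain_subset_with_card_n by blast
    with e show "e \<in> (\<Union>A \<in> subsets_of_card (f \<inter> S) l. {e \<in> subsets_of_card S r. A \<subseteq> e})"
      by (auto simp: subsets_of_card_def)
  qed
  then have "card {e \<in> subsets_of_card S r. l \<le> card (e \<inter> f)}
    \<le> card (\<Union>A \<in> subsets_of_card (f \<inter> S) l. {e \<in> subsets_of_card S r. A \<subseteq> e})"
    using assms by (intro card_mono) auto
  also have "\<dots> \<le> (\<Sum>A \<in> subsets_of_card (f \<inter> S) l. card {e \<in> subsets_of_card S r. A \<subseteq> e})"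
    using assms by (intro card_UN_le) auto
  also have "\<dots> \<le> (\<Sum>A \<in> subsets_of_card (f \<inter> S) l. (card S - l) choose (r - l))"
  proof (rule sum_mono)
    fix A assume "A \<in> subsets_of_card (f \<inter> S) l"
    then show "card {e \<in> subsets_of_card S r. A \<subseteq> e} \<le> (card S - l) choose (r - l)"
      using card_supersets_le[OF assms, of A r] by (auto simp: subsets_of_card_def)
  qed
  also have "\<dots> = (card (f \<inter> S) choose l) * ((card S - l) choose (r - l))"
    using assms by simp
  finally show ?thesis .
qed

lemma card_allowed_ge:
  assumes "finite S" "finite M"
  shows "card S choose r \<le> card (allowed r l M S) + load l M S * ((card S - l) choose (r - l))"
proof -
  have "subsets_of_card S r \<subseteq> allowed r l M S \<union> (\<Union>f\<in>M. {e \<in> subsets_of_card S r. l \<le> card (e \<inter> f)})"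
    by (force simp: allowed_def)
  then have "card (subsets_of_card S r)
      \<le> card (allowed r l M S \<union> (\<Union>f\<in>M. {e \<in> subsets_of_card S r. l \<le> card (e \<inter> f)}))"
    using assms by (intro card_mono) auto
  also have "\<dots> \<le> card (allowed r l M S) + card (\<Union>f\<in>M. {e \<in> subsets_of_card S r. l \<le> card (e \<inter> f)})"
    by (rule card_Un_le)
  also have "card (\<Union>f\<in>M. {e \<in> subsets_of_card S r. l \<le> card (e \<inter> f)})
      \<le> (\<Sum>f\<in>M. card {e \<in> subsets_of_card S r. l \<le> card (e \<inter> f)})"
    using assms by (intro card_UN_le) auto
  also have "\<dots> \<le> (\<Sum>f\<in>M. (card (f \<inter> S) choose l) * ((card S - l) choose (r - l)))"
    using assms by (intro sum_mono card_blocked_le) auto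
  also have "\<dots> = load l M S * ((card S - l) choose (r - l))"
    by (simp add: load_def sum_distrib_right)
  finally show ?thesis using assms by simp
qed

text \<open>Both sides come from counting the pairs \<open>A \<subseteq> f\<close> with
  \<open>A\<close> an \<open>l\<close>-subset of \<open>S\<close> and \<open>f\<close> an
  \<open>r\<close>-subset of \<open>V\<close>.\<close>

lemma sum_choose_card_Int_le:
  assumes "finite V" "S \<subseteq> V"
  shows "(\<Sum>f \<in> subsets_of_card V r. card (f \<inter> S) choose l)
    \<le> (card S choose l) * ((card V - l) choose (r - l))"
proof -
  have fS: "finite S" using assms finite_subset by blast
  have "(\<Sum>f \<in> subsets_of_card V r. card (f \<inter> S) choose l)
      = (\<Sum>f \<in> subsets_of_card V r. card {A \<in> subsets_of_card S l. A \<subseteq> f})"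
  proof (rule sum.cong)
    fix f assume "f \<in> subsets_of_card V r"
    have "{A \<in> subsets_of_card S l. A \<subseteq> f} = subsets_of_card (f \<inter> S) l"
      by (auto simp: subsets_of_card_def)
    then show "card (f \<inter> S) choose l = card {A \<in> subsets_of_card S l. A \<subseteq> f}"
      using fS by simp
  qed simp
  also have "\<dots> = (\<Sum>A \<in> subsets_of_card S l. card {f \<in> subsets_of_card V r. A \<subseteq> f})"
    using assms fS by (intro sum_multicount_gen) auto
  also have "\<dots> \<le> (\<Sum>A \<in> subsets_of_card S l. (card V - l) choose (r - l))"
  proof (rule sum_mono)
    fix A assume "A \<in> subsets_of_card S l"
    then show "card {f \<in> subsets_of_card V r. A \<subseteq> f} \<le> (card V - l) choose (r - l)"
      using card_supersets_le[OF assms(1), of A r] assms by (auto simp: subsets_of_card_def)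
  qed
  also have "\<dots> = (card S choose l) * ((card V - l) choose (r - l))"
    using fS by simp
  finally show ?thesis .
qed

section \<open>The exponential weight and the supply of available edges\<close>

lemma exp_le_one_plus_double:
  fixes y :: real assumes "0 \<le> y" "y \<le> 1" shows "exp y \<le> 1 + 2 * y"
proof -
  have "y\<^sup>2 \<le> y" using assms by (simp add: power2_eq_square mult_left_le)
  then show ?thesis using exp_bound[OF assms] by linarith
qed

text \<open>
  The exponent is nonnegative as soon as the load exceeds the threshold up to which
  at least half of the \<open>r\<close>-subsets of \<open>S\<close> are available.
\<close>

definition load_weight :: "nat \<Rightarrow> nat \<Rightarrow> 'a set set \<Rightarrow> 'a set \<Rightarrow> real" where
  "load_weight r l M S = exp (real (load l M S) / real (r choose l)
     - real (card S choose l) / (2 * (real (r choose l))\<^sup>2))"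

text \<open>Each edge covers \<open>r choose l\<close> of the \<open>l\<close>-subsets of
  \<open>V\<close>. By \<open>choose_mult\<close> the blocked share of all \<open>r\<close>-sets is
  at most \<open>card M * (r choose l)^2 / (card V choose l)\<close>, which \<open>small\<close>
  keeps at most one half.\<close>

lemma card_allowed_ge_half_of_card:
  assumes V: "finite V" and M: "M \<subseteq> subsets_of_card V r" and lr: "l \<le> r" "r \<le> card V"
    and small: "2 * card M * (r choose l)\<^sup>2 \<le> card V choose l"
  shows "card V choose r \<le> 2 * card (allowed r l M V)"
proof -
  let ?n = "card V" and ?R = "r choose l"
  have fM: "finite M" using M V finite_subset finite_subsets_of_card by blast
  have "f \<inter> V = f \<and> card f = r" if "f \<in> M" for f
    using that M by (auto simp: subsets_of_card_def)
  then have ld: "load l M V = card M * ?R"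
    by (simp add: load_def)
  have pos: "0 < ?n choose l" using lr by simp
  have "(?n choose r) * ?R = (?n choose l) * ((?n - l) choose (r - l))"
    using choose_mult[OF lr] .
  then have "2 * (card M * ?R * ((?n - l) choose (r - l))) * (?n choose l)
      = 2 * card M * ?R\<^sup>2 * (?n choose r)"
    by (simp add: power2_eq_square algebra_simps)
  also have "\<dots> \<le> (?n choose l) * (?n choose r)"
    using small by (intro mult_right_mono) auto
  finally have "2 * (card M * ?R * ((?n - l) choose (r - l))) \<le> ?n choose r"
    using pos by (simp add: mult.commute)
  then show ?thesis
    using card_allowed_ge[OF V fM, of r l] ld by simp
qed

text \<open>The condition \<open>small\<close> says that the exponent in \<open>load_weight\<close>
  is at most 0. So either half of the \<open>r\<close>-subsets of \<open>S\<close> are available or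
  \<open>S\<close> has weight above 1.\<close>

lemma card_allowed_ge_half_of_load:
  assumes S: "finite S" and M: "finite M" and lr: "l \<le> r" "r \<le> card S"
    and small: "2 * (r choose l) * load l M S \<le> card S choose l"
  shows "card S choose r \<le> 2 * card (allowed r l M S)"
proof -
  let ?n = "card S" and ?R = "r choose l"
  have pos: "0 < ?R" using lr by simp
  have "2 * (load l M S * ((?n - l) choose (r - l))) * ?R
      = (2 * ?R * load l M S) * ((?n - l) choose (r - l))"
    by (simp add: algebra_simps)
  also have "\<dots> \<le> (?n choose l) * ((?n - l) choose (r - l))"
    using small by (intro mult_right_mono) auto
  also have "\<dots> = (?n choose r) * ?R"
    using choose_mult[OF lr] by simp
  finally have "2 * (load l M S * ((?n - l) choose (r - l))) \<le> ?n choose r"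
    using pos by simp
  then show ?thesis
    using card_allowed_ge[OF S M, of r l] by linarith
qed

section \<open>Averages over the available edges\<close>

text \<open>After exchanging the sums, a set \<open>S\<close> of small load contains at least a
  share \<open>q\<close> of the available edges. A set of large load has weight at least 1, and the
  term with \<open>load_weight\<close> makes up for the share it may miss.\<close>

lemma sum_card_independent_sets_insert_le:
  fixes q :: real
  assumes V: "finite V" and M: "finite M" and lr: "l \<le> r" "r \<le> s"
    and q: "0 \<le> q" "2 * q * real (card V choose r) \<le> real (s choose r)"
  shows "(\<Sum>f\<in>allowed r l M V. real (card (independent_sets V s (insert f M))))
    \<le> real (card (allowed r l M V)) * ((1 - q) * real (card (independent_sets V s M))
        + q * (\<Sum>S\<in>subsets_of_card V s. load_weight r l M S))"
proof -
  let ?A = "allowed r l M V" and ?I = "independent_sets V s M"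
  have fA: "finite ?A" using V by simp
  have fI: "finite ?I" using V by (simp add: independent_sets_def)
  have R: "0 < r choose l" using lr by simp
  have key: "real (card {f \<in> ?A. \<not> f \<subseteq> S}) \<le> real (card ?A) * (1 - q + q * load_weight r l M S)"
    if S: "S \<in> ?I" for S
  proof -
    have SV: "S \<subseteq> V" "card S = s" using S by (auto simp: independent_sets_def subsets_of_card_def)
    have fS: "finite S" using SV V finite_subset by blast
    show ?thesis
    proof (cases "2 * (r choose l) * load l M S \<le> card S choose l")
      case True
      have sub: "allowed r l M S \<subseteq> ?A" using SV by (auto simp: allowed_def subsets_of_card_def)
      have eq: "{f \<in> ?A. \<not> f \<subseteq> S} = ?A - allowed r l M S"
        by (auto simp: allowed_def subsets_of_card_def)
      \<comment> \<open>The hypothesis on \<open>q\<close> refers to all \<open>r\<close>-subsets of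
        \<open>V\<close>; having fewer available edges in total only raises the share lying in
        \<open>S\<close>.\<close>
      have "card ?A \<le> card (subsets_of_card V r)"
        using V by (intro card_mono) (auto simp: allowed_def)
      then have "q * real (card ?A) \<le> q * real (card V choose r)"
        using q V by (intro mult_left_mono) auto
      also have "\<dots> \<le> real (s choose r) / 2" using q by simp
      also have "\<dots> \<le> real (card (allowed r l M S))"
        using card_allowed_ge_half_of_load[OF fS M lr(1) _ True] lr SV by simp
      finally have 1: "q * real (card ?A) \<le> real (card (allowed r l M S))" .
      have "real (card {f \<in> ?A. \<not> f \<subseteq> S}) = real (card ?A) - real (card (allowed r l M S))"
        unfolding eq using sub fA by (simp add: card_Diff_subset finite_subset of_nat_diff card_mono)
      also have "\<dots> \<le> real (card ?A) * (1 - q)" using 1 by (simp add: algebra_simps)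
      also have "\<dots> \<le> real (card ?A) * (1 - q + q * load_weight r l M S)"
        using q by (intro mult_left_mono) (auto simp: load_weight_def)
      finally show ?thesis .
    next
      case False
      then have "real (card S choose l) \<le> 2 * real (r choose l) * real (load l M S)"
        by (metis (mono_tags, lifting) nat_le_linear of_nat_le_iff of_nat_mult of_nat_numeral)
      then have "1 \<le> load_weight r l M S"
        using R by (simp add: load_weight_def field_simps power2_eq_square)
      then have "1 * 1 \<le> 1 - q + q * load_weight r l M S"
        using q mult_left_mono[of 1 "load_weight r l M S" q] by simp
      then have "real (card ?A) \<le> real (card ?A) * (1 - q + q * load_weight r l M S)"
        by (simp add: mult_le_cancel_left1)
      moreover have "card {f \<in> ?A. \<not> f \<subseteq> S} \<le> card ?A" using fA by (intro card_mono) auto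
      ultimately show ?thesis by linarith
    qed
  qed
  have "(\<Sum>f\<in>?A. real (card (independent_sets V s (insert f M))))
      = (\<Sum>f\<in>?A. real (card {S \<in> ?I. \<not> f \<subseteq> S}))"
    by (intro sum.cong refl arg_cong[where f = "\<lambda>X. real (card X)"]) (auto simp: independent_sets_def)
  also have "\<dots> = (\<Sum>S\<in>?I. real (card {f \<in> ?A. \<not> f \<subseteq> S}))"
    unfolding of_nat_sum[symmetric] using fA fI
    by (intro arg_cong[where f = real] sum_multicount_gen) auto
  also have "\<dots> \<le> (\<Sum>S\<in>?I. real (card ?A) * (1 - q + q * load_weight r l M S))"
    by (intro sum_mono key)
  also have "\<dots> = real (card ?A) * ((1 - q) * real (card ?I) + q * (\<Sum>S\<in>?I. load_weight r l M S))"
    unfolding sum_distrib_left[symmetric] sum.distrib by simp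
  \<comment> \<open>Weights are positive, so the sum may be extended to all \<open>s\<close>-sets, a
    family that does not change with \<open>M\<close>.\<close>
  also have "\<dots> \<le> real (card ?A) * ((1 - q) * real (card ?I)
      + q * (\<Sum>S\<in>subsets_of_card V s. load_weight r l M S))"
    using q V by (intro mult_left_mono add_left_mono sum_mono2)
      (auto simp: independent_sets_def load_weight_def)
  finally show ?thesis .
qed

lemma load_weight_insert:
  assumes "finite M" "f \<notin> M"
  shows "load_weight r l (insert f M) S
    = load_weight r l M S * exp (real (card (f \<inter> S) choose l) / real (r choose l))"
  using assms by (simp add: load_weight_def load_def exp_add[symmetric] add_divide_distrib)

text \<open>An edge \<open>f\<close> multiplies the weight of \<open>S\<close> by the exponential of
  a number between 0 and 1. Linearising that exponential reduces the average growth to the double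
  count of \<open>l\<close>-subsets.\<close>

lemma sum_load_weight_insert_le:
  assumes V: "finite V" and M: "M \<subseteq> subsets_of_card V r" and lr: "l \<le> r" "r \<le> card V"
    and small: "2 * card M * (r choose l)\<^sup>2 \<le> card V choose l"
  shows "(\<Sum>f\<in>allowed r l M V. \<Sum>S\<in>subsets_of_card V s. load_weight r l (insert f M) S)
    \<le> real (card (allowed r l M V)) * (1 + 4 * real (s choose l) / real (card V choose l))
        * (\<Sum>S\<in>subsets_of_card V s. load_weight r l M S)"
proof -
  let ?A = "allowed r l M V" and ?R = "real (r choose l)" and ?n = "card V"
  let ?\<mu> = "4 * real (s choose l) / real (?n choose l)"
  have fM: "finite M" using M V finite_subset finite_subsets_of_card by blast
  have fA: "finite ?A" using V by simp
  have R: "0 < ?R" using lr by simp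
  have B: "0 < real (?n choose l)" using lr by simp
  have notin: "f \<notin> M" if "f \<in> ?A" for f
    using that lr by (auto simp: allowed_def subsets_of_card_def)
  have key: "(\<Sum>f\<in>?A. load_weight r l (insert f M) S)
      \<le> load_weight r l M S * (real (card ?A) * (1 + ?\<mu>))"
    if S: "S \<in> subsets_of_card V s" for S
  proof -
    have SV: "S \<subseteq> V" "card S = s" using S by (auto simp: subsets_of_card_def)
    have step: "exp (real (card (f \<inter> S) choose l) / ?R) \<le> 1 + 2 * (real (card (f \<inter> S) choose l) / ?R)"
      if f: "f \<in> ?A" for f
    proof (rule exp_le_one_plus_double)
      have ff: "card f = r" "finite f"
        using f V finite_subset by (auto simp: allowed_def subsets_of_card_def)
      then have "card (f \<inter> S) \<le> r" by (metis Int_lower1 card_mono)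
      then have "card (f \<inter> S) choose l \<le> r choose l" by (rule binomial_right_mono)
      then show "real (card (f \<inter> S) choose l) / ?R \<le> 1" using R by simp
    qed simp
    have "real (\<Sum>f\<in>?A. card (f \<inter> S) choose l)
        \<le> real (\<Sum>f\<in>subsets_of_card V r. card (f \<inter> S) choose l)"
      unfolding of_nat_le_iff using V by (intro sum_mono2) (auto simp: allowed_def)
    also have "\<dots> \<le> real ((s choose l) * ((?n - l) choose (r - l)))"
      unfolding of_nat_le_iff using sum_choose_card_Int_le[OF V SV(1)] SV by simp
    also have "\<dots> = real (s choose l) * real (?n choose r) * ?R / real (?n choose l)"
    proof -
      have "real (?n choose r) * ?R = real (?n choose l) * real ((?n - l) choose (r - l))"
        by (metis choose_mult[OF lr] of_nat_mult)
      then show ?thesis using B by (simp add: field_simps)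
    qed
    \<comment> \<open>Averaging over available edges instead of all \<open>r\<close>-sets costs a
      factor 2; with the 2 from linearising the exponential this gives the 4 in
      \<open>?\<mu>\<close>.\<close>
    also have "\<dots> \<le> real (s choose l) * (2 * real (card ?A)) * ?R / real (?n choose l)"
    proof -
      have "real (?n choose r) \<le> 2 * real (card ?A)"
        using card_allowed_ge_half_of_card[OF assms] by (metis of_nat_le_iff of_nat_mult of_nat_numeral)
      then show ?thesis by (intro divide_right_mono mult_right_mono mult_left_mono) auto
    qed
    finally have 1: "real (\<Sum>f\<in>?A. card (f \<inter> S) choose l) / ?R
        \<le> real (s choose l) * (2 * real (card ?A)) / real (?n choose l)"
      using R by (simp add: field_simps)
    have eq: "(\<Sum>f\<in>?A. load_weight r l (insert f M) S)
        = load_weight r l M S * (\<Sum>f\<in>?A. exp (real (card (f \<inter> S) choose l) / ?R))"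
      using notin fM by (simp add: load_weight_insert sum_distrib_left)
    have "(\<Sum>f\<in>?A. exp (real (card (f \<inter> S) choose l) / ?R))
        \<le> (\<Sum>f\<in>?A. 1 + 2 * (real (card (f \<inter> S) choose l) / ?R))"
      by (intro sum_mono step)
    also have "(\<Sum>f\<in>?A. 1 + 2 * (real (card (f \<inter> S) choose l) / ?R))
        = real (card ?A) + 2 * (real (\<Sum>f\<in>?A. card (f \<inter> S) choose l) / ?R)"
      by (simp add: sum.distrib sum_distrib_left sum_divide_distrib)
    also have "\<dots> \<le> real (card ?A) + 2 * (real (s choose l) * (2 * real (card ?A)) / real (?n choose l))"
      using 1 by linarith
    also have "\<dots> = real (card ?A) * (1 + ?\<mu>)"
      by (simp add: algebra_simps)
    finally show ?thesis using eq by (simp add: load_weight_def)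
  qed
  have "(\<Sum>f\<in>?A. \<Sum>S\<in>subsets_of_card V s. load_weight r l (insert f M) S)
      = (\<Sum>S\<in>subsets_of_card V s. \<Sum>f\<in>?A. load_weight r l (insert f M) S)"
    by (rule sum.swap)
  also have "\<dots> \<le> (\<Sum>S\<in>subsets_of_card V s. load_weight r l M S * (real (card ?A) * (1 + ?\<mu>)))"
    by (intro sum_mono key)
  finally show ?thesis unfolding sum_distrib_right[symmetric] by (simp only: mult_ac)
qed

section \<open>The potential and the successive choice of edges\<close>

text \<open>The coefficients \<open>a\<close> and \<open>b\<close> change from step to step: they
  anticipate the factors that the remaining steps contribute to the two terms.\<close>

definition potential ::
  "nat \<Rightarrow> nat \<Rightarrow> nat \<Rightarrow> 'a set \<Rightarrow> real \<Rightarrow> real \<Rightarrow> 'a set set \<Rightarrow> real" where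
  "potential r l s V a b M = a * real (card (independent_sets V s M))
     + b * (\<Sum>S\<in>subsets_of_card V s. load_weight r l M S)"

text \<open>
  A set \<open>S\<close> with large load may fail to lose its share \<open>q\<close>, which adds \<open>q\<close> times its weight;
  the extra \<open>q\<close> in the growth factor of \<open>b\<close> pays for that because \<open>a \<le> b\<close>.
\<close>

lemma potential_step:
  fixes q :: real
  assumes V: "finite V" and M: "M \<subseteq> subsets_of_card V r" and lr: "l \<le> r" "r \<le> s" "r \<le> card V"
    and small: "2 * card M * (r choose l)\<^sup>2 \<le> card V choose l"
    and q: "0 \<le> q" "2 * q * real (card V choose r) \<le> real (s choose r)"
    and ab: "0 \<le> a" "a \<le> b"
  obtains f where "f \<in> allowed r l M V"
    "potential r l s V a b (insert f M)
      \<le> potential r l s V ((1 - q) * a) ((1 + 4 * real (s choose l) / real (card V choose l) + q) * b) M"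
proof -
  let ?A = "allowed r l M V"
  let ?\<mu> = "4 * real (s choose l) / real (card V choose l)"
  let ?Z = "\<Sum>S\<in>subsets_of_card V s. load_weight r l M S" and ?Y = "real (card (independent_sets V s M))"
  have fM: "finite M" using M V finite_subset finite_subsets_of_card by blast
  have fA: "finite ?A" using V by simp
  have "0 < card V choose r" using lr by simp
  then have ne: "?A \<noteq> {}"
    using card_allowed_ge_half_of_card[OF V M lr(1,3) small] by fastforce
  have Z0: "0 \<le> ?Z" by (intro sum_nonneg) (simp add: load_weight_def)
  let ?P = "potential r l s V ((1 - q) * a) ((1 + ?\<mu> + q) * b) M"
  have "(\<Sum>f\<in>?A. potential r l s V a b (insert f M))
      = a * (\<Sum>f\<in>?A. real (card (independent_sets V s (insert f M))))
        + b * (\<Sum>f\<in>?A. \<Sum>S\<in>subsets_of_card V s. load_weight r l (insert f M) S)"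
    by (simp add: potential_def sum.distrib sum_distrib_left)
  also have "\<dots> \<le> a * (real (card ?A) * ((1 - q) * ?Y + q * ?Z))
      + b * (real (card ?A) * (1 + ?\<mu>) * ?Z)"
    using ab sum_card_independent_sets_insert_le[OF V fM lr(1,2) q]
      sum_load_weight_insert_le[OF V M lr(1,3) small, of s]
    by (intro add_mono mult_left_mono) auto
  also have "\<dots> = real (card ?A) * ((1 - q) * a * ?Y + ((1 + ?\<mu>) * b + q * a) * ?Z)"
    by (simp add: algebra_simps)
  also have "\<dots> \<le> real (card ?A) * ((1 - q) * a * ?Y + ((1 + ?\<mu>) * b + q * b) * ?Z)"
    using ab q Z0 by (intro mult_left_mono add_left_mono mult_right_mono) auto
  also have "\<dots> = real (card ?A) * ?P" by (simp add: potential_def algebra_simps)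
  also have "\<dots> = (\<Sum>f\<in>?A. ?P)" by simp
  finally have le: "(\<Sum>f\<in>?A. potential r l s V a b (insert f M)) \<le> (\<Sum>f\<in>?A. ?P)" .
  have "\<exists>f\<in>?A. potential r l s V a b (insert f M) \<le> ?P"
  proof (rule ccontr)
    assume "\<not> ?thesis"
    then have "(\<Sum>f\<in>?A. ?P) < (\<Sum>f\<in>?A. potential r l s V a b (insert f M))"
      using fA ne by (intro sum_strict_mono) auto
    with le show False by simp
  qed
  with that show ?thesis by blast
qed

lemma rl_system_insert:
  assumes "rl_system r l V M" "finite V" "f \<in> allowed r l M V"
  shows "rl_system r l V (insert f M)"
  using assms by (auto simp: rl_system_def r_graph_def hypergraph_def allowed_def
      subsets_of_card_def Int_commute)

text \<open>Method of conditional expectations: \<open>less1\<close> says that the potential of the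
  empty edge set is below 1, and each edge is chosen so that the potential does not
  increase.\<close>

lemma rl_system_exists:
  fixes q :: real
  assumes V: "finite V" and lr: "l \<le> r" "r \<le> s" "r \<le> card V"
    and small: "2 * m * (r choose l)\<^sup>2 \<le> card V choose l"
    and q: "0 \<le> q" "q \<le> 1" "2 * q * real (card V choose r) \<le> real (s choose r)"
    and less1: "(1 - q) ^ m * real (card V choose s)
      + (1 + 4 * real (s choose l) / real (card V choose l) + q) ^ m * real (card V choose s)
          * exp (- real (s choose l) / (2 * (real (r choose l))\<^sup>2)) < 1"
  obtains E where "rl_system r l V E" "card E = m"
    "\<And>S. S \<subseteq> V \<Longrightarrow> card S = s \<Longrightarrow> \<exists>e\<in>E. e \<subseteq> S"
proof -
  let ?g = "1 + 4 * real (s choose l) / real (card V choose l) + q"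
  have g1: "1 \<le> ?g" using q by simp
  \<comment> \<open>The exponent \<open>m - i\<close> is the number of edges still to be
    chosen.\<close>
  let ?pot = "\<lambda>i. potential r l s V ((1 - q) ^ (m - i)) (?g ^ (m - i))"
  have ind0: "independent_sets V s {} = subsets_of_card V s"
    by (auto simp: independent_sets_def)
  have "(\<Sum>S\<in>subsets_of_card V s. load_weight r l {} S)
      = (\<Sum>S\<in>subsets_of_card V s. exp (- real (s choose l) / (2 * (real (r choose l))\<^sup>2)))"
    by (intro sum.cong) (auto simp: load_weight_def load_def subsets_of_card_def)
  then have pot0: "?pot 0 {} < 1"
    using less1 V by (simp add: potential_def ind0 mult_ac)
  have "\<exists>M. rl_system r l V M \<and> card M = i \<and> ?pot i M < 1" if "i \<le> m" for i
    using that
  proof (induction i)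
    case 0
    have "rl_system r l V {}" using V by (auto simp: rl_system_def r_graph_def hypergraph_def)
    with pot0 show ?case by (intro exI[of _ "{}"]) simp
  next
    case (Suc i)
    then obtain M where M: "rl_system r l V M" "card M = i" "?pot i M < 1" by auto
    have Msub: "M \<subseteq> subsets_of_card V r"
      using M(1) by (auto simp: rl_system_def r_graph_def hypergraph_def subsets_of_card_def)
    have fM: "finite M" using Msub V finite_subset finite_subsets_of_card by blast
    have "2 * card M * (r choose l)\<^sup>2 \<le> 2 * m * (r choose l)\<^sup>2"
      using M(2) Suc.prems by (intro mult_right_mono) auto
    then have sm: "2 * card M * (r choose l)\<^sup>2 \<le> card V choose l" using small by linarith
    have "(1 - q) ^ (m - Suc i) \<le> 1" using q by (intro power_le_one) auto
    also have "1 \<le> ?g ^ (m - Suc i)" using g1 by (rule one_le_power)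
    finally have ab: "(1 - q) ^ (m - Suc i) \<le> ?g ^ (m - Suc i)" .
    have a0: "0 \<le> (1 - q) ^ (m - Suc i)" using q by simp
    have eq: "m - i = Suc (m - Suc i)" using Suc.prems by simp
    obtain f where f: "f \<in> allowed r l M V" "?pot (Suc i) (insert f M)
        \<le> potential r l s V ((1 - q) * (1 - q) ^ (m - Suc i)) (?g * ?g ^ (m - Suc i)) M"
      by (rule potential_step[OF V Msub lr sm q(1,3) a0 ab])
    have "?pot (Suc i) (insert f M) \<le> ?pot i M"
      using f(2) by (simp only: eq power_Suc)
    with M(3) have less: "?pot (Suc i) (insert f M) < 1" by linarith
    have "f \<notin> M" using f(1) lr by (auto simp: allowed_def subsets_of_card_def)
    then have "card (insert f M) = Suc i" using M(2) fM by simp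
    then show ?case using less rl_system_insert[OF M(1) V f(1)] by blast
  qed
  then obtain E where E: "rl_system r l V E" "card E = m" "?pot m E < 1" by blast
  have "0 \<le> (\<Sum>S\<in>subsets_of_card V s. load_weight r l E S)"
    by (intro sum_nonneg) (simp add: load_weight_def)
  \<comment> \<open>At \<open>i = m\<close> both coefficients are 1, so the potential bounds this
    count.\<close>
  then have "card (independent_sets V s E) < 1"
    using E(3) by (simp add: potential_def)
  moreover have "finite (independent_sets V s E)" using V by (simp add: independent_sets_def)
  ultimately have "independent_sets V s E = {}" by simp
  then have "\<exists>e\<in>E. e \<subseteq> S" if "S \<subseteq> V" "card S = s" for S
    using that by (auto simp: independent_sets_def subsets_of_card_def)
  with E that show ?thesis by blast
qed

section \<open>From \<open>s\<close>-sets containing edges to the chromatic number\<close>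

text \<open>By pigeonhole some colour class has at least \<open>s\<close> vertices; an
  \<open>s\<close>-subset of it contains an edge, which is monochromatic.\<close>

lemma chromatic_number_gt:
  assumes V: "finite V" "card V = k * s" and k: "0 < k"
    and E: "\<And>S. S \<subseteq> V \<Longrightarrow> card S = s \<Longrightarrow> \<exists>e\<in>E. e \<subseteq> S"
  shows "chromatic_number V E > enat k"
proof -
  \<comment> \<open>The infimum in \<open>chromatic_number\<close> ranges over all numbers of
    colours, so every \<open>j \<le> k\<close> is excluded.\<close>
  have "\<not> proper_coloring V E j f" if j: "j \<le> k" for j f
  proof
    assume pc: "proper_coloring V E j f"
    then have im: "f ` V \<subseteq> {..<k}" using j by (fastforce simp: proper_coloring_def)
    have "\<exists>c<k. s \<le> card {v\<in>V. f v = c}"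
    proof (rule ccontr)
      assume "\<not> ?thesis"
      then have lt: "card {v\<in>V. f v = c} < s" if "c < k" for c using that by force
      have "card V = (\<Sum>c<k. card {v\<in>V. f v = c})"
        using sum.group[OF V(1) _ im, of "\<lambda>_. 1::nat"] by simp
      also have "\<dots> < (\<Sum>c<k. s)"
        using lt k by (intro sum_strict_mono) auto
      finally show False using V by simp
    qed
    then obtain c where "s \<le> card {v\<in>V. f v = c}" by blast
    then obtain S where "S \<subseteq> {v\<in>V. f v = c}" "card S = s"
      using obtain_subset_with_card_n by blast
    with E[of S] obtain e where "e \<in> E" "\<forall>v\<in>e. f v = c" by blast
    then have "monochromatic f e" unfolding monochromatic_def by blast
    with pc \<open>e \<in> E\<close> show False by (auto simp: proper_coloring_def)
  qed
  \<comment> \<open>This includes the case of no proper colouring at all, where the infimum is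
    \<infinity>.\<close>
  then have "enat (Suc k) \<le> chromatic_number V E"
    unfolding chromatic_number_def by (intro INF_greatest) (auto simp: not_less_eq_eq[symmetric])
  then show ?thesis by (metis eSuc_enat iless_Suc_eq ileI1 Suc_ile_eq)
qed

lemma min_edges_le:
  assumes lr: "l \<le> r" "r \<le> s" "r \<le> k * s" and k: "0 < k"
    and small: "2 * m * (r choose l)\<^sup>2 \<le> (k * s) choose l"
    and q: "0 \<le> q" "q \<le> 1" "2 * q * real (k * s choose r) \<le> real (s choose r)"
    and less1: "(1 - q) ^ m * real (k * s choose s)
      + (1 + 4 * real (s choose l) / real (k * s choose l) + q) ^ m * real (k * s choose s)
          * exp (- real (s choose l) / (2 * (real (r choose l))\<^sup>2)) < 1"
  shows "min_edges k r l \<le> enat m"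
proof -
  let ?V = "{..<k * s}"
  obtain E where E: "rl_system r l ?V E" "card E = m"
    "\<And>S. S \<subseteq> ?V \<Longrightarrow> card S = s \<Longrightarrow> \<exists>e\<in>E. e \<subseteq> S"
    by (rule rl_system_exists[of ?V l r s m q]) (use assms in auto)
  have "chromatic_number ?V E > enat k"
    by (rule chromatic_number_gt[OF _ _ k E(3)]) auto
  then show ?thesis
    unfolding min_edges_def using E by (intro INF_lower2[of "(?V, E)"]) auto
qed


section \<open>Elementary estimates for binomial coefficients and exponentials\<close>

text \<open>The falling factorial is at least \<open>(n - l)^l = n^l (1 - l/n)^l\<close>, and by
  Bernoulli the last factor is at least \<open>1 - l^2/n \<ge> 1/2\<close>.\<close>

lemma power_le_choose:
  assumes "2 * l\<^sup>2 \<le> n" "0 < n"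
  shows "real n ^ l \<le> 2 * fact l * real (n choose l)"
proof -
  let ?x = "1 - real l / real n"
  have ln: "real l \<le> real n" using assms
    by (metis (no_types, lifting) le_square le_trans mult_2 le_add1 of_nat_le_iff power2_eq_square)
  have "2 * (real l)\<^sup>2 \<le> real n"
    using assms(1) by (metis of_nat_le_iff of_nat_mult of_nat_numeral of_nat_power)
  then have "1 / 2 \<le> 1 + real l * (- real l / real n)"
    using assms(2) by (simp add: field_simps power2_eq_square)
  also have "\<dots> \<le> ?x ^ l"
    using Bernoulli_inequality[of "- real l / real n" l] assms(2) ln by simp
  finally have "real n ^ l / 2 \<le> (real n * ?x) ^ l"
    using mult_left_mono[of "1/2" "?x ^ l" "real n ^ l"] by (simp add: power_mult_distrib)
  also have "real n * ?x = real n - real l" using assms by (simp add: field_simps)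
  also have "(real n - real l) ^ l = (\<Prod>i = 0..<l. real n - real l)" by simp
  also have "\<dots> \<le> (\<Prod>i = 0..<l. real n - real i)"
    using ln by (intro prod_mono) auto
  also have "\<dots> = fact l * real (n choose l)"
    by (simp add: binomial_gbinomial gbinomial_mult_fact)
  finally show ?thesis by simp
qed

lemma choose_mult_fact_le: "real (n choose r) * fact r \<le> real n ^ r"
proof -
  have "real ((n choose r) * fact r) \<le> real (n ^ r)"
    unfolding of_nat_le_iff by (rule binomial_fact_pow)
  then show ?thesis by simp
qed

text \<open>The term of index \<open>s\<close> in the exponential series at \<open>s\<close> is at
  most the whole sum.\<close>

lemma power_self_le_fact_exp: "real s ^ s \<le> fact s * exp (real s)"
proof -
  have "(\<Sum>n\<in>{s}. real s ^ n /\<^sub>R fact n) \<le> (\<Sum>n. real s ^ n /\<^sub>R fact n)"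
    by (intro sum_le_suminf summable_exp_generic) auto
  also have "\<dots> = exp (real s)" by (simp add: exp_def)
  finally have "(\<Sum>n\<in>{s}. real s ^ n /\<^sub>R fact n) \<le> exp (real s)" .
  then show ?thesis by (simp add: field_simps)
qed

text \<open>The entropy of the choice of \<open>S\<close>: \<open>(k s)^s / s!\<close> is at most
  \<open>(e k)^s\<close>.\<close>

lemma choose_le_exp:
  assumes "0 < k" "0 < s"
  shows "real (k * s choose s) \<le> exp (real s * (1 + ln (real k)))"
proof -
  have "real (k * s choose s) * fact s \<le> real k ^ s * real s ^ s"
    using choose_mult_fact_le[of "k * s" s] by (simp add: power_mult_distrib)
  also have "\<dots> \<le> real k ^ s * (fact s * exp (real s))"
    by (intro mult_left_mono power_self_le_fact_exp) simp
  finally have "real (k * s choose s) \<le> real k ^ s * exp (real s)" by simp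
  also have "real k ^ s = exp (real s * ln (real k))"
    using assms by (simp add: exp_of_nat_mult)
  also have "\<dots> * exp (real s) = exp (real s * (1 + ln (real k)))"
    by (simp add: exp_add[symmetric] algebra_simps)
  finally show ?thesis .
qed

lemma one_plus_power_le_exp:
  fixes x :: real assumes "- 1 \<le> x" shows "(1 + x) ^ m \<le> exp (real m * x)"
proof -
  have "(1 + x) ^ m \<le> exp x ^ m" using assms by (intro power_mono exp_ge_add_one_self) auto
  then show ?thesis by (simp add: exp_of_nat_mult)
qed

section \<open>The choice of \<open>q\<close> and the initial potential\<close>

text \<open>The window for \<open>m\<close> leaves room for rounding. Hypothesis \<open>n\<close>
  keeps the covered share of \<open>l\<close>-sets small, and \<open>s'\<close> makes the load
  exponent beat the entropy.\<close>

lemma min_edges_le_of_bounds: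
  assumes lr: "2 \<le> l" "l \<le> r" and k: "2 \<le> ln (real k)" and s: "2 * r\<^sup>2 \<le> s"
  defines "L \<equiv> real k ^ (r - 1) * ln (real k)"
  assumes m: "8 * real (k * s) * L \<le> real m" "real m \<le> 9 * real (k * s) * L"
    and n: "1000 * fact l * (real (r choose l))\<^sup>2 * L \<le> real (k * s) ^ (l - 1)"
    and s': "40 * fact l * (real (r choose l))\<^sup>2 * ln (real k) \<le> real s ^ (l - 1)"
  shows "min_edges k r l \<le> enat m"
proof -
  define R where "R = real (r choose l)"
  \<comment> \<open>About a share \<open>k^(-r)\<close> of the \<open>r\<close>-sets lies in
    \<open>S\<close>. One factor 2 pays for the half of them that may be blocked, the other for the
    loss in \<open>power_le_choose\<close>.\<close>
  define q where "q = 1 / (4 * real k ^ r)"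
  have k0: "0 < k" using k by (cases k) auto
  have rr: "r \<le> r\<^sup>2" by (simp add: power2_eq_square)
  have rs: "r \<le> s" using s rr by linarith
  have s2: "2 \<le> s" using rs lr by linarith
  have ks: "s \<le> k * s" using k0 by simp
  have l2: "2 * l\<^sup>2 \<le> s" using s power_mono[OF lr(2), of 2] by linarith
  have R0: "0 < R" using lr by (simp add: R_def)
  have kr: "real k ^ r = real k * real k ^ (r - 1)"
    using lr by (cases r) auto
  have kr0: "0 < real k ^ r" using k0 by simp
  define B where "B = real (s choose l)"
  define N where "N = real (k * s choose l)"
  have B0: "0 < B" using rs lr by (simp add: B_def)
  have "l \<le> k * s" using rs lr(2) ks by linarith
  then have N0: "0 < N" by (simp add: N_def)
  have pow: "real x ^ l = real x * real x ^ (l - 1)" for x :: nat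
    using lr by (cases l) auto
  have sN: "real (k * s) ^ l \<le> 2 * fact l * N"
    unfolding N_def using order_trans[OF l2 ks] s2 k0 by (intro power_le_choose) auto
  have sB: "real s ^ l \<le> 2 * fact l * B"
    unfolding B_def using l2 s2 by (intro power_le_choose) auto
  \<comment> \<open>The constant 50 is generous: \<open>small\<close> needs 2 and the growth of the
    weights needs 16.\<close>
  have mR: "50 * real m * R\<^sup>2 \<le> N"
  proof -
    have "real m * (1000 * fact l * R\<^sup>2) \<le> 9 * real (k * s) * L * (1000 * fact l * R\<^sup>2)"
      using m(2) by (intro mult_right_mono) auto
    also have "\<dots> = 9 * real (k * s) * (1000 * fact l * R\<^sup>2 * L)" by (simp add: algebra_simps)
    also have "\<dots> \<le> 9 * real (k * s) * real (k * s) ^ (l - 1)"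
      using n by (intro mult_left_mono) (auto simp: R_def)
    also have "\<dots> = 9 * real (k * s) ^ l" by (simp only: pow mult.assoc)
    also have "\<dots> \<le> 20 * fact l * N" using sN zero_le_power[of "real (k * s)" l] by linarith
    finally have "fact l * (20 * (50 * real m * R\<^sup>2)) \<le> fact l * (20 * N)" by (simp add: algebra_simps)
    then show ?thesis by simp
  qed
  have q0: "0 \<le> q" by (simp add: q_def)
  have q1: "q \<le> 1"
  proof -
    have "1 \<le> real k ^ r" using k0 by simp
    then have "1 \<le> 4 * real k ^ r" by linarith
    then show ?thesis unfolding q_def by (subst divide_le_eq_1) linarith
  qed
  have mq: "2 * (real s * ln (real k)) \<le> real m * q" "real m * q \<le> 9 / 4 * (real s * ln (real k))"
  proof -
    have "real (k * s) * L = real k ^ r * (real s * ln (real k))"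
      by (simp add: L_def kr)
    then have "8 * (real k ^ r * (real s * ln (real k))) \<le> real m"
      "real m \<le> 9 * (real k ^ r * (real s * ln (real k)))"
      using m by (metis mult.assoc)+
    then show "2 * (real s * ln (real k)) \<le> real m * q" "real m * q \<le> 9 / 4 * (real s * ln (real k))"
      using kr0 by (simp_all add: q_def field_simps)
  qed
  have sk: "2 * real s \<le> real s * ln (real k)"
    using k s2 mult_left_mono[of 2 "ln (real k)" "real s"] by simp
  \<comment> \<open>Each summand of \<open>less1\<close> will be at most 1/3, so that their sum is
    below 1.\<close>
  have half: "exp x \<le> 1 / 3" if "x \<le> - 2" for x :: real
  proof -
    have "exp x \<le> exp (- 2)" using that by simp
    also have "\<dots> = 1 / exp 2" by (simp add: exp_minus field_simps)
    also have "\<dots> \<le> 1 / 3" using exp_ge_add_one_self[of 2] by (intro divide_left_mono) auto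
    finally show ?thesis .
  qed
  have choose: "real (k * s choose s) \<le> exp (real s * (1 + ln (real k)))"
    using k0 s2 by (intro choose_le_exp) auto
  have "(1 - q) ^ m * real (k * s choose s) \<le> exp (- (real m * q)) * exp (real s * (1 + ln (real k)))"
    using one_plus_power_le_exp[of "- q" m] q1 by (intro mult_mono choose) auto
  also have "\<dots> = exp (real s * (1 + ln (real k)) - real m * q)" by (simp add: exp_add[symmetric])
  also have "\<dots> \<le> 1 / 3"
  proof (rule half)
    show "real s * (1 + ln (real k)) - real m * q \<le> - 2"
      using mq(1) sk s2 unfolding distrib_left by linarith
  qed
  finally have t1: "(1 - q) ^ m * real (k * s choose s) \<le> 1 / 3" .
  \<comment> \<open>Over all \<open>m\<close> steps the expected load uses up at most half of the
    threshold \<open>B / (2 * R^2)\<close>.\<close>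
  have m\<mu>: "real m * (4 * B / N) \<le> B / (4 * R\<^sup>2)"
  proof -
    have "0 \<le> real m * R\<^sup>2" by simp
    then have "16 * real m * R\<^sup>2 \<le> N" using mR by linarith
    then have "(16 * real m * R\<^sup>2) * B \<le> N * B" using B0 by (intro mult_right_mono) auto
    then show ?thesis using R0 N0 by (simp add: field_simps)
  qed
  \<comment> \<open>The other half of the threshold exceeds the entropy and \<open>m * q\<close>
    together, which need less than 4 times \<open>s ln k\<close>.\<close>
  have BR: "5 * (real s * ln (real k)) \<le> B / (4 * R\<^sup>2)"
  proof -
    have "real s * (40 * fact l * R\<^sup>2 * ln (real k)) \<le> real s * real s ^ (l - 1)"
      using s' by (intro mult_left_mono) (auto simp: R_def)
    also have "\<dots> \<le> 2 * fact l * B" using sB by (simp only: pow)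
    finally have "fact l * (2 * (R\<^sup>2 * (20 * real s * ln (real k)))) \<le> fact l * (2 * B)" by (simp add: algebra_simps)
    then have "20 * (real s * (ln (real k) * R\<^sup>2)) \<le> B" by (simp add: mult_ac)
    then show ?thesis using R0 by (simp add: field_simps)
  qed
  have "0 \<le> 4 * B / N + q" using q0 B0 N0 by simp
  then have "(1 + 4 * B / N + q) ^ m \<le> exp (real m * (4 * B / N + q))"
    using one_plus_power_le_exp[of "4 * B / N + q" m] by (simp add: add.assoc)
  then have "(1 + 4 * B / N + q) ^ m * real (k * s choose s) * exp (- B / (2 * R\<^sup>2))
    \<le> exp (real m * (4 * B / N + q)) * exp (real s * (1 + ln (real k))) * exp (- B / (2 * R\<^sup>2))"
    by (intro mult_right_mono mult_mono choose) auto
  also have "\<dots> = exp (real m * (4 * B / N) + real m * q + real s * (1 + ln (real k)) - B / (2 * R\<^sup>2))"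
    by (simp add: exp_add[symmetric] distrib_left)
  also have "\<dots> \<le> 1 / 3"
  proof (rule half)
    have "B / (2 * R\<^sup>2) = 2 * (B / (4 * R\<^sup>2))" by simp
    then show "real m * (4 * B / N) + real m * q + real s * (1 + ln (real k)) - B / (2 * R\<^sup>2) \<le> - 2"
      using m\<mu> BR mq(2) sk s2 unfolding distrib_left by linarith
  qed
  finally have t2: "(1 + 4 * B / N + q) ^ m * real (k * s choose s) * exp (- B / (2 * R\<^sup>2)) \<le> 1 / 3" .
  have qq: "2 * q * real (k * s choose r) \<le> real (s choose r)"
  proof -
    have "2 * q * real (k * s choose r) * fact r \<le> 2 * q * real (k * s) ^ r"
      using q0 choose_mult_fact_le[of "k * s" r] by (simp add: mult.assoc mult_left_mono)
    also have "\<dots> = real s ^ r / 2"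
      using kr0 by (simp add: q_def power_mult_distrib field_simps)
    also have "\<dots> \<le> real (s choose r) * fact r"
      using power_le_choose[of r s] s s2 by (simp add: mult_ac)
    finally show ?thesis by simp
  qed
  show ?thesis
  proof (rule min_edges_le[OF lr(2) rs _ k0 _ q0 q1 qq])
    show "r \<le> k * s" using rs ks by linarith
    have "real (2 * m * (r choose l)\<^sup>2) \<le> 50 * real m * R\<^sup>2"
      by (simp add: R_def mult_right_mono)
    also have "\<dots> \<le> real (k * s choose l)" using mR by (simp add: N_def)
    finally show "2 * m * (r choose l)\<^sup>2 \<le> k * s choose l" by (simp only: of_nat_le_iff)
  qed (use t1 t2 in \<open>simp add: B_def N_def R_def\<close>)
qed

section \<open>The constant \<open>c_const\<close> and the choice of \<open>s\<close> and
  \<open>m\<close>\<close>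

lemma falling_factorial_eq: "falling_factorial r l = fact l * real (r choose l)"
  by (simp add: falling_factorial_def binomial_gbinomial gbinomial_mult_fact atLeast0LessThan)

text \<open>With \<open>p = 1/(l-1)\<close> one has
  \<open>20 (1000 F)^p = 2 (100 F)^p 10^(1+p)\<close>; the constant on the right exceeds this by the
  factor \<open>\<rho>^(1+p)\<close>, which is at least 1.\<close>

lemma c_const_ge:
  assumes lr: "2 \<le> l" "l < r" and L: "0 < L"
  shows "20 * (1000 * fact l * (real (r choose l))\<^sup>2 * L) powr (1 / (real l - 1)) * L
    \<le> c_const r l * L powr (real l / (real l - 1))"
proof -
  define p where "p = 1 / (real l - 1)"
  define F :: real where "F = fact l * (real (r choose l))\<^sup>2"
  define \<rho> where "\<rho> = (real r - 1) / (real l - 1)"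
  have p: "real l / (real l - 1) = 1 + p" "0 < p" using lr by (simp_all add: p_def field_simps)
  have \<rho>: "1 \<le> \<rho>" using lr by (simp add: \<rho>_def field_simps)
  have F0: "0 < F" using lr by (simp add: F_def)
  have "100 * (falling_factorial r l)\<^sup>2 / fact l = 100 * F"
    by (simp add: falling_factorial_eq F_def power_mult_distrib power2_eq_square)
  moreover have "10 * (real r - 1) / (real l - 1) = 10 * \<rho>" by (simp add: \<rho>_def)
  ultimately have c: "c_const r l = 2 * (100 * F) powr p * (10 * \<rho>) powr (1 + p)"
    by (simp add: c_const_def p(1)) (simp add: p_def)
  have "20 * (1000 * F * L) powr p * L = 2 * (100 * F) powr p * 10 powr (1 + p) * L powr (1 + p)"
    using F0 L powr_mult[of "10::real" "100 * F" p] by (simp add: powr_mult powr_add)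
  also have "\<dots> \<le> 2 * (100 * F) powr p * (10 * \<rho>) powr (1 + p) * L powr (1 + p)"
    using \<rho> p(2) by (intro mult_right_mono mult_left_mono powr_mono2) auto
  finally show ?thesis unfolding c p(1) p_def[symmetric] by (simp add: F_def mult_ac)
qed

text \<open>The first condition on \<open>k\<close> lets \<open>s ln k\<close> absorb terms of order
  \<open>s\<close>; the second makes \<open>s\<close> at least \<open>2 r^2\<close>.\<close>

lemma min_edges_less:
  assumes lr: "2 \<le> l" "l < r" and k: "2 \<le> ln (real k)" "(2 * r\<^sup>2) ^ (l - 1) \<le> k"
  shows "\<exists>m. min_edges k r l \<le> enat m \<and>
    real m < c_const r l * (real k ^ (r - 1) * ln (real k)) powr (real l / (real l - 1))"
proof -
  define L where "L = real k ^ (r - 1) * ln (real k)"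
  define P :: real where "P = 1000 * fact l * (real (r choose l))\<^sup>2"
  \<comment> \<open>The target number of vertices, solving \<open>y^(l-1) = P L\<close>; rounding it
    up to a multiple of \<open>k\<close> gives \<open>k s\<close>.\<close>
  define y where "y = (P * L) powr (1 / (real l - 1))"
  define s where "s = nat \<lceil>y / real k\<rceil>"
  define m where "m = nat \<lceil>8 * real (k * s) * L\<rceil>"
  have k0: "0 < k" using k by (cases k) auto
  have k1: "1 \<le> real k" using k0 by simp
  have "1 \<le> real k ^ (r - 1)" using k1 by simp
  then have L1: "2 \<le> L"
    unfolding L_def using k(1) mult_mono[of 1 "real k ^ (r - 1)" 2 "ln (real k)"] by simp
  have "1 \<le> r choose l" using lr by (simp add: Suc_leI)
  then have "1 \<le> (real (r choose l))\<^sup>2" by simp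
  moreover have "(1::real) \<le> fact l" by simp
  ultimately have "1 * 1 \<le> fact l * (real (r choose l))\<^sup>2" by (intro mult_mono) auto
  then have P1: "1 \<le> P" by (simp add: P_def)
  have PL0: "0 < P * L" using P1 L1 by simp
  have y0: "0 < y" using P1 L1 by (simp add: y_def)
  have ypow: "y ^ (l - 1) = P * L"
  proof -
    have "y ^ (l - 1) = y powr real (l - 1)" using y0 by (simp add: powr_realpow)
    also have "\<dots> = P * L" using lr PL0 by (simp add: y_def powr_powr of_nat_diff)
    finally show ?thesis .
  qed
  have sy: "y / real k \<le> real s" "real s \<le> y / real k + 1"
    using y0 k1 by (auto simp: s_def)
  have ny: "y \<le> real (k * s)" "real (k * s) \<le> y + real k"
    using sy k1 by (simp_all add: field_simps)
  \<comment> \<open>Hence rounding at most doubles the number of vertices: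
    \<open>k s \<le> y + k \<le> 2 y\<close>.\<close>
  have yk: "real k \<le> y"
  proof -
    have "real k ^ (l - 1) * 1 \<le> real k ^ (r - 1) * ln (real k)"
      using k1 lr k(1) by (intro mult_mono power_increasing) auto
    also have "\<dots> \<le> P * L" using P1 L1 mult_right_mono[of 1 P L] unfolding L_def[symmetric] by simp
    finally have "real k ^ (l - 1) \<le> y ^ (l - 1)" by (simp only: ypow mult_1_right)
    then show ?thesis using power_mono_iff[of "real k" y "l - 1"] y0 lr by simp
  qed
  have spow: "P * real k * ln (real k) \<le> real s ^ (l - 1)"
  proof -
    have "r - 1 = (l - 1) + (r - l)" using lr by simp
    then have eq: "real k ^ (r - 1) = real k ^ (l - 1) * real k ^ (r - l)"
      by (metis power_add)
    \<comment> \<open>Here \<open>l < r\<close> supplies the factor \<open>k\<close> by which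
      \<open>s^(l-1)\<close> outgrows \<open>ln k\<close>.\<close>
    have "real k ^ 1 \<le> real k ^ (r - l)" using k1 lr by (intro power_increasing) auto
    then have "P * real k * ln (real k) \<le> P * real k ^ (r - l) * ln (real k)"
      using P1 k(1) by (intro mult_right_mono mult_left_mono) auto
    also have "\<dots> = (y / real k) ^ (l - 1)"
      using k0 unfolding power_divide ypow L_def eq by simp
    also have "\<dots> \<le> real s ^ (l - 1)" using sy(1) y0 k1 by (intro power_mono) auto
    finally show ?thesis .
  qed
  have sr: "2 * r\<^sup>2 \<le> s"
  proof -
    have "real ((2 * r\<^sup>2) ^ (l - 1)) \<le> real k" using k(2) by (simp only: of_nat_le_iff)
    also have "1 * real k * 1 \<le> P * real k * ln (real k)"
      using P1 k1 k(1) by (intro mult_mono) auto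
    also have "\<dots> \<le> real (s ^ (l - 1))" using spow by simp
    finally have "(2 * r\<^sup>2) ^ (l - 1) \<le> s ^ (l - 1)" by (simp only: of_nat_le_iff mult_1 mult_1_right)
    then show ?thesis using power_mono_iff[of "2 * r\<^sup>2" s "l - 1"] lr by simp
  qed
  have nL: "1 \<le> real (k * s) * L"
    using ny(1) yk k1 L1 mult_mono[of 1 "real (k * s)" 1 L] by linarith
  have m: "8 * real (k * s) * L \<le> real m" "real m \<le> 9 * real (k * s) * L"
    unfolding m_def using nL by linarith+
  have "min_edges k r l \<le> enat m"
  proof (rule min_edges_le_of_bounds[OF lr(1) _ k(1) sr m[unfolded L_def]])
    show "1000 * fact l * (real (r choose l))\<^sup>2 * (real k ^ (r - 1) * ln (real k)) \<le> real (k * s) ^ (l - 1)"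
      using ypow power_mono[OF ny(1), of "l - 1"] y0 by (simp add: P_def L_def)
    have "40 * fact l * (real (r choose l))\<^sup>2 * 1 * ln (real k) \<le> P * real k * ln (real k)"
      using k1 k(1) unfolding P_def by (intro mult_right_mono mult_mono) auto
    with spow show "40 * fact l * (real (r choose l))\<^sup>2 * ln (real k) \<le> real s ^ (l - 1)" by simp
  qed (use lr in simp)
  moreover have "real m < c_const r l * L powr (real l / (real l - 1))"
  proof -
    \<comment> \<open>The gap between 18 and 20 gives the strict inequality.\<close>
    have "real m \<le> 9 * (2 * y) * L"
      using m(2) ny(2) yk L1 mult_right_mono[of "real (k * s)" "2 * y" L] by linarith
    also have "\<dots> < 20 * y * L" using y0 L1 by simp
    also have "\<dots> \<le> c_const r l * L powr (real l / (real l - 1))"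
      using c_const_ge[OF lr, of L] L1 by (simp add: y_def P_def)
    finally show ?thesis .
  qed
  ultimately show ?thesis unfolding L_def by blast
qed

theorem theorem5:
  fixes r l :: nat
  assumes "2 \<le> l" and "l < r"
  shows "\<forall>\<^sub>F k in sequentially.
           ereal_of_enat (min_edges k r l)
             < ereal (c_const r l * (real k ^ (r - 1) * ln (real k)) powr (real l / (real l - 1)))"
proof -
  have "filterlim (\<lambda>k. ln (real k)) at_top sequentially"
    by (rule filterlim_compose[OF ln_at_top filterlim_real_sequentially])
  then have "\<forall>\<^sub>F k in sequentially. 2 \<le> ln (real k)" by (simp add: filterlim_at_top)
  moreover have "\<forall>\<^sub>F k in sequentially. (2 * r\<^sup>2) ^ (l - 1) \<le> k" by (rule eventually_ge_at_top)
  ultimately show ?thesis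
  proof eventually_elim
    case (elim k)
    obtain m where m: "min_edges k r l \<le> enat m"
      "real m < c_const r l * (real k ^ (r - 1) * ln (real k)) powr (real l / (real l - 1))"
      using min_edges_less[OF assms elim] by blast
    have "ereal_of_enat (min_edges k r l) \<le> ereal_of_enat (enat m)"
      using m(1) by (simp only: ereal_of_enat_le_iff)
    also have "\<dots> = ereal (real m)" by simp
    also have "\<dots> < ereal (c_const r l * (real k ^ (r - 1) * ln (real k)) powr (real l / (real l - 1)))"
      using m(2) by simp
    finally show ?case .
  qed
qed

end
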